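(* Let $(\mathfrak{H},\mathfrak{B},\mathfrak{B}^{\dagger})$ be a standard $C^{*}$-base, let $H$ be a finite-dimensional Hilbert space, let $\rho\colon \mathfrak{B}^{\dagger}\to\mathcal{L}(H)$ be a nondegenerate faithful representation, and let $\alpha$ be a $C^{*}$-factorization of $H$ with respect to $(\mathfrak{H},\mathfrak{B},\mathfrak{B}^{\dagger})$. Then: (i) There exists a unique nondegenerate faithful representation $\rho_{\alpha}\colon\mathfrak{B}^{\dagger}\to\mathcal{L}(H)$ such that $\rho_{\alpha}(b^{\dagger})\,\xi\omega=\xi b^{\dagger}\omega$ for all $b^{\dagger}\in\mathfrak{B}^{\dagger}$, $\xi\in\alpha$, $\omega\in\mathfrak{H}$. (ii) The space $\mathcal{L}^{\rho}(\mathfrak{H},H)$ is a $C^{*}$-factorization of $H$ with respect to $(\mathfrak{H},\mathfrak{B},\mathfrak{B}^{\dagger})$. (iii) $\rho_{\alpha}=\rho$ if and only if $\alpha=\mathcal{L}^{\rho}(\mathfrak{H},H)$.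
   Context: For a subset $Y$ of a normed space, $[Y]$ denotes its closed linear span; for sets of operators (and vectors), $XY$ is the set of products $xy$, and $X^{*}=\{x^{*}\mid x\in X\}$. A $C^{*}$-base is a triple $(\mathfrak{H},\mathfrak{B},\mathfrak{B}^{\dagger})$ consisting of a Hilbert space $\mathfrak{H}$ and two commuting nondegenerate $C^{*}$-algebras $\mathfrak{B},\mathfrak{B}^{\dagger}\subseteq\mathcal{L}(\mathfrak{H})$. A vector $\zeta\in\mathfrak{H}$ is bicyclic if it is cyclic for $\mathfrak{B}$ and for $\mathfrak{B}^{\dagger}$. The $C^{*}$-base is standard if a bicyclic vector exists. A $C^{*}$-factorization of a Hilbert space $H$ with respect to $(\mathfrak{H},\mathfrak{B},\mathfrak{B}^{\dagger})$ is a closed subspace $\alpha\subseteq\mathcal{L}(\mathfrak{H},H)$ with $[\alpha^{*}\alpha]=\mathfrak{B}$, $[\alpha\mathfrak{B}]=\alpha$, and $[\alpha\mathfrak{H}]=H$. For a representation $\rho\colon\mathfrak{B}^{\dagger}\to\mathcal{L}(H)$, put $\mathcal{L}^{\rho}(\mathfrak{H},H)=\{T\in\mathcal{L}(\mathfrak{H},H)\mid Tb^{\dagger}=\rho(b^{\dagger})T\text{ for all }b^{\dagger}\in\mathfrak{B}^{\dagger}\}$. *)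

theory Defs
  imports "HOL-Analysis.Analysis" "HOL-Library.FuncSet"
begin

section \<open>Complex vector spaces and Hilbert spaces\<close>

text \<open>
  The complex structure is layered on top of the real type classes of the library, so that
  norms, topology, completeness and operator norms are those of the library.
\<close>

class scaleC =
  fixes scaleC :: "complex \<Rightarrow> 'a \<Rightarrow> 'a" (infixr "*\<^sub>C" 75)

class complex_vector = real_vector + scaleC +
  assumes scaleC_add_right: "a *\<^sub>C (x + y) = a *\<^sub>C x + a *\<^sub>C y"
    and scaleC_add_left: "(a + b) *\<^sub>C x = a *\<^sub>C x + b *\<^sub>C x"
    and scaleC_scaleC: "a *\<^sub>C (b *\<^sub>C x) = (a * b) *\<^sub>C x"
    and scaleC_one: "1 *\<^sub>C x = x"
    and scaleR_scaleC: "r *\<^sub>R x = complex_of_real r *\<^sub>C x"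

global_interpretation complex_vector: vector_space "scaleC :: complex \<Rightarrow> 'a \<Rightarrow> 'a::complex_vector"
  defines csubspace = complex_vector.subspace
    and cspan = complex_vector.span
  by unfold_locales
    (auto simp: scaleC_add_right scaleC_add_left scaleC_scaleC scaleC_one)

class complex_normed_vector = complex_vector + real_normed_vector +
  assumes norm_scaleC: "norm (a *\<^sub>C x) = cmod a * norm x"

text \<open>The inner product is conjugate-linear in the first argument.\<close>

class complex_inner = complex_vector + real_inner +
  fixes cinner :: "'a \<Rightarrow> 'a \<Rightarrow> complex"
  assumes cinner_commute: "cinner x y = cnj (cinner y x)"
    and cinner_add_right: "cinner x (y + z) = cinner x y + cinner x z"
    and cinner_scaleC_right: "cinner x (a *\<^sub>C y) = a * cinner x y"
    and inner_cinner: "inner x y = Re (cinner x y)"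

lemma cinner_self: "cinner x x = complex_of_real ((norm x)\<^sup>2)"
  for x :: "'a::complex_inner"
proof -
  have "Im (cinner x x) = - Im (cinner x x)"
    using arg_cong[OF cinner_commute[of x x], of Im] by simp
  moreover have "Re (cinner x x) = (norm x)\<^sup>2"
    by (simp add: inner_cinner[symmetric] power2_norm_eq_inner)
  ultimately show ?thesis by (simp add: complex_eq_iff)
qed

subclass (in complex_inner) complex_normed_vector
proof
  fix a :: complex and x :: 'a
  have left: "cinner (a *\<^sub>C x) z = cnj a * cinner x z" for z
    using cinner_commute[of "a *\<^sub>C x" z] cinner_commute[of x z]
    by (simp add: cinner_scaleC_right)
  have "cinner (a *\<^sub>C x) (a *\<^sub>C x) = (a * cnj a) * cinner x x"
    by (simp add: left cinner_scaleC_right)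
  also have "\<dots> = complex_of_real ((cmod a)\<^sup>2) * cinner x x"
    by (simp only: complex_norm_square)
  finally have "inner (a *\<^sub>C x) (a *\<^sub>C x) = (cmod a)\<^sup>2 * inner x x"
    by (simp add: inner_cinner)
  then show "norm (a *\<^sub>C x) = cmod a * norm x"
    by (simp add: norm_eq_sqrt_inner real_sqrt_mult)
qed

class complex_hilbert = complex_inner + complete_space

text \<open>
  The closed linear span \<open>[Y]\<close>.
\<close>

definition closed_cspan :: "'a::complex_normed_vector set \<Rightarrow> 'a set" where
  "closed_cspan Y = closure (cspan Y)"

section \<open>Bounded operators\<close>

text \<open>
  The library type \<open>'a \<Rightarrow>\<^sub>L 'b\<close> consists of the bounded \<^emph>\<open>real\<close>-linear maps with the operator
  norm. With pointwise multiplication by scalars of the codomain it is a complex normed space.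
  The space of bounded complex-linear operators is the subspace \<open>clinear_ops\<close> below.
\<close>

instantiation blinfun :: (real_normed_vector, complex_normed_vector) complex_normed_vector
begin

lift_definition scaleC_blinfun :: "complex \<Rightarrow> 'a \<Rightarrow>\<^sub>L 'b \<Rightarrow> 'a \<Rightarrow>\<^sub>L 'b"
  is "\<lambda>c f x. c *\<^sub>C f x"
proof -
  fix c :: complex and f :: "'a \<Rightarrow> 'b"
  assume "bounded_linear f"
  then interpret bounded_linear f .
  obtain K where K: "\<And>x. norm (f x) \<le> norm x * K" using bounded by blast
  show "bounded_linear (\<lambda>x. c *\<^sub>C f x)"
  proof (rule bounded_linear_intro)
    fix x y and r :: real
    show "c *\<^sub>C f (x + y) = c *\<^sub>C f x + c *\<^sub>C f y"
      by (simp add: add scaleC_add_right)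
    show "c *\<^sub>C f (r *\<^sub>R x) = r *\<^sub>R (c *\<^sub>C f x)"
      by (simp add: scale scaleR_scaleC scaleC_scaleC mult.commute)
    show "norm (c *\<^sub>C f x) \<le> norm x * (cmod c * K)"
      using mult_left_mono[OF K[of x], of "cmod c"] by (simp add: norm_scaleC mult_ac)
  qed
qed

instance
proof
  fix a b :: complex and x y :: "'a \<Rightarrow>\<^sub>L 'b" and r :: real
  show "a *\<^sub>C (x + y) = a *\<^sub>C x + a *\<^sub>C y"
    by transfer (simp add: scaleC_add_right)
  show "(a + b) *\<^sub>C x = a *\<^sub>C x + b *\<^sub>C x"
    by transfer (simp add: scaleC_add_left)
  show "a *\<^sub>C (b *\<^sub>C x) = (a * b) *\<^sub>C x"
    by transfer (simp add: scaleC_scaleC)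
  show "1 *\<^sub>C x = x"
    by transfer (simp add: scaleC_one)
  show "r *\<^sub>R x = complex_of_real r *\<^sub>C x"
    by transfer (simp add: scaleR_scaleC)
  have le: "norm (c *\<^sub>C z) \<le> cmod c * norm z" for c and z :: "'a \<Rightarrow>\<^sub>L 'b"
  proof (rule norm_blinfun_bound)
    fix v
    have "norm (blinfun_apply (c *\<^sub>C z) v) = cmod c * norm (blinfun_apply z v)"
      by (simp add: scaleC_blinfun.rep_eq norm_scaleC)
    also have "\<dots> \<le> cmod c * (norm z * norm v)"
      by (intro mult_left_mono norm_blinfun) simp
    finally show "norm (blinfun_apply (c *\<^sub>C z) v) \<le> cmod c * norm z * norm v"
      by (simp add: mult.assoc)
  qed simp
  show "norm (a *\<^sub>C x) = cmod a * norm x"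
  proof (cases "a = 0")
    case True
    then show ?thesis using le[of a x] by simp
  next
    case False
    have "x = inverse a *\<^sub>C (a *\<^sub>C x)"
      using False by transfer (simp add: scaleC_scaleC scaleC_one)
    then have "norm x \<le> inverse (cmod a) * norm (a *\<^sub>C x)"
      using le[of "inverse a" "a *\<^sub>C x"] by (simp add: norm_inverse)
    then have "cmod a * norm x \<le> norm (a *\<^sub>C x)"
      using False by (simp add: field_simps)
    then show ?thesis using le[of a x] by simp
  qed
qed

end

definition clinear_ops :: "('a::complex_normed_vector \<Rightarrow>\<^sub>L 'b::complex_normed_vector) set" where
  "clinear_ops = {T. \<forall>c x. blinfun_apply T (c *\<^sub>C x) = c *\<^sub>C blinfun_apply T x}"

text \<open>
  By the Riesz representation theorem the description is proper for every operator in
  \<open>clinear_ops\<close> between Hilbert spaces; the adjoint is only used for such operators.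
\<close>

definition adj :: "('a::complex_hilbert \<Rightarrow>\<^sub>L 'b::complex_hilbert) \<Rightarrow> ('b \<Rightarrow>\<^sub>L 'a)" where
  "adj T = (THE S. \<forall>x y. cinner (blinfun_apply S y) x = cinner y (blinfun_apply T x))"

definition op_products ::
  "('b::real_normed_vector \<Rightarrow>\<^sub>L 'c::real_normed_vector) set
    \<Rightarrow> ('a::real_normed_vector \<Rightarrow>\<^sub>L 'b) set \<Rightarrow> ('a \<Rightarrow>\<^sub>L 'c) set" where
  "op_products X Y = {S o\<^sub>L T | S T. S \<in> X \<and> T \<in> Y}"

definition op_images ::
  "('a::real_normed_vector \<Rightarrow>\<^sub>L 'b::real_normed_vector) set \<Rightarrow> 'a set \<Rightarrow> 'b set" where
  "op_images X V = {blinfun_apply T v | T v. T \<in> X \<and> v \<in> V}"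

section \<open>Concrete C*-algebras and their representations\<close>

definition cstar_algebra :: "('h::complex_hilbert \<Rightarrow>\<^sub>L 'h) set \<Rightarrow> bool" where
  "cstar_algebra A \<longleftrightarrow>
     A \<subseteq> clinear_ops \<and> csubspace A \<and> closed A \<and>
     (\<forall>S\<in>A. \<forall>T\<in>A. S o\<^sub>L T \<in> A) \<and> (\<forall>T\<in>A. adj T \<in> A)"

definition nondegenerate :: "('h::complex_hilbert \<Rightarrow>\<^sub>L 'h) set \<Rightarrow> bool" where
  "nondegenerate A \<longleftrightarrow> closed_cspan (op_images A UNIV) = UNIV"

definition cyclic :: "('h::complex_hilbert \<Rightarrow>\<^sub>L 'h) set \<Rightarrow> 'h \<Rightarrow> bool" where
  "cyclic A \<zeta> \<longleftrightarrow> closed_cspan (op_images A {\<zeta>}) = UNIV"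

text \<open>
  A representation is a *-homomorphism. It is encoded as an extensional function on its domain
  \<open>A\<close>, so that equality of representations of \<open>A\<close> is equality of functions.
\<close>

definition representation ::
  "('h::complex_hilbert \<Rightarrow>\<^sub>L 'h) set
    \<Rightarrow> (('h \<Rightarrow>\<^sub>L 'h) \<Rightarrow> ('k::complex_hilbert \<Rightarrow>\<^sub>L 'k)) \<Rightarrow> bool" where
  "representation A \<rho> \<longleftrightarrow>
     \<rho> \<in> A \<rightarrow>\<^sub>E clinear_ops \<and>
     (\<forall>S\<in>A. \<forall>T\<in>A. \<rho> (S + T) = \<rho> S + \<rho> T) \<and>
     (\<forall>c. \<forall>T\<in>A. \<rho> (c *\<^sub>C T) = c *\<^sub>C \<rho> T) \<and>
     (\<forall>S\<in>A. \<forall>T\<in>A. \<rho> (S o\<^sub>L T) = \<rho> S o\<^sub>L \<rho> T) \<and>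
     (\<forall>T\<in>A. \<rho> (adj T) = adj (\<rho> T))"

definition nondegenerate_faithful_representation ::
  "('h::complex_hilbert \<Rightarrow>\<^sub>L 'h) set
    \<Rightarrow> (('h \<Rightarrow>\<^sub>L 'h) \<Rightarrow> ('k::complex_hilbert \<Rightarrow>\<^sub>L 'k)) \<Rightarrow> bool" where
  "nondegenerate_faithful_representation A \<rho> \<longleftrightarrow>
     representation A \<rho> \<and> nondegenerate (\<rho> ` A) \<and> inj_on \<rho> A"

section \<open>C*-bases and C*-factorizations\<close>

text \<open>The underlying Hilbert space of the C*-base is the type \<open>'h\<close>.\<close>

definition cstar_base ::
  "('h::complex_hilbert \<Rightarrow>\<^sub>L 'h) set \<Rightarrow> ('h \<Rightarrow>\<^sub>L 'h) set \<Rightarrow> bool" where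
  "cstar_base B Bd \<longleftrightarrow>
     cstar_algebra B \<and> nondegenerate B \<and> cstar_algebra Bd \<and> nondegenerate Bd \<and>
     (\<forall>b\<in>B. \<forall>b'\<in>Bd. b o\<^sub>L b' = b' o\<^sub>L b)"

definition bicyclic ::
  "('h::complex_hilbert \<Rightarrow>\<^sub>L 'h) set \<Rightarrow> ('h \<Rightarrow>\<^sub>L 'h) set \<Rightarrow> 'h \<Rightarrow> bool" where
  "bicyclic B Bd \<zeta> \<longleftrightarrow> cyclic B \<zeta> \<and> cyclic Bd \<zeta>"

definition standard_cstar_base ::
  "('h::complex_hilbert \<Rightarrow>\<^sub>L 'h) set \<Rightarrow> ('h \<Rightarrow>\<^sub>L 'h) set \<Rightarrow> bool" where
  "standard_cstar_base B Bd \<longleftrightarrow> cstar_base B Bd \<and> (\<exists>\<zeta>. bicyclic B Bd \<zeta>)"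

text \<open>
  The factorized Hilbert space is the type \<open>'k\<close>. The condition does not involve the second
  algebra of the base.
\<close>

definition cstar_factorization ::
  "('h::complex_hilbert \<Rightarrow>\<^sub>L 'h) set \<Rightarrow> ('h \<Rightarrow>\<^sub>L 'h) set
    \<Rightarrow> ('h \<Rightarrow>\<^sub>L 'k::complex_hilbert) set \<Rightarrow> bool" where
  "cstar_factorization B Bd \<alpha> \<longleftrightarrow>
     \<alpha> \<subseteq> clinear_ops \<and> csubspace \<alpha> \<and> closed \<alpha> \<and>
     closed_cspan (op_products (adj ` \<alpha>) \<alpha>) = B \<and>
     closed_cspan (op_products \<alpha> B) = \<alpha> \<and>
     closed_cspan (op_images \<alpha> UNIV) = UNIV"

definition intertwiners ::
  "('h::complex_hilbert \<Rightarrow>\<^sub>L 'h) set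
    \<Rightarrow> (('h \<Rightarrow>\<^sub>L 'h) \<Rightarrow> ('k::complex_hilbert \<Rightarrow>\<^sub>L 'k)) \<Rightarrow> ('h \<Rightarrow>\<^sub>L 'k) set" where
  "intertwiners Bd \<rho> = {T \<in> clinear_ops. \<forall>b\<in>Bd. T o\<^sub>L b = \<rho> b o\<^sub>L T}"

definition induces_representation ::
  "('h::complex_hilbert \<Rightarrow>\<^sub>L 'h) set \<Rightarrow> ('h \<Rightarrow>\<^sub>L 'k::complex_hilbert) set
    \<Rightarrow> (('h \<Rightarrow>\<^sub>L 'h) \<Rightarrow> ('k \<Rightarrow>\<^sub>L 'k)) \<Rightarrow> bool" where
  "induces_representation Bd \<alpha> \<sigma> \<longleftrightarrow>
     nondegenerate_faithful_representation Bd \<sigma> \<and>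
     (\<forall>b\<in>Bd. \<forall>\<xi>\<in>\<alpha>. \<forall>\<omega>.
        blinfun_apply (\<sigma> b) (blinfun_apply \<xi> \<omega>) = blinfun_apply \<xi> (blinfun_apply b \<omega>))"

text \<open>The representation \<open>\<rho>\<^sub>\<alpha>\<close>, meaningful once unique existence is known.\<close>

definition induced_representation ::
  "('h::complex_hilbert \<Rightarrow>\<^sub>L 'h) set \<Rightarrow> ('h \<Rightarrow>\<^sub>L 'k::complex_hilbert) set
    \<Rightarrow> ('h \<Rightarrow>\<^sub>L 'h) \<Rightarrow> ('k \<Rightarrow>\<^sub>L 'k)" where
  "induced_representation Bd \<alpha> = (THE \<sigma>. induces_representation Bd \<alpha> \<sigma>)"

end

theory Submission
  imports Defs
begin

text \<open>
  Write \<open>h\<close> for the Hilbert space of the base, \<open>H\<close> for the finite-dimensional space, \<open>\<L>\<close> for the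
  space of intertwiners from \<open>h\<close> to \<open>H\<close>, and \<open>\<zeta>\<close> for a bicyclic vector. The faithful
  representation \<open>\<rho>\<close> embeds \<open>Bd\<close> into the operators on \<open>H\<close>, so \<open>Bd\<close> is finite dimensional, and so
  is \<open>h\<close>, which is the closure of \<open>Bd \<zeta>\<close> (\<open>finite_dim_if_cyclic\<close>). Every linear subspace of \<open>h\<close>
  or \<open>H\<close> is therefore closed, and \<open>B \<zeta>\<close> and \<open>Bd \<zeta>\<close> are all of \<open>h\<close>.
  An operator that intertwines the action of \<open>Bd\<close> is determined by its value at \<open>\<zeta>\<close>
  (\<open>intertwiner_eqI\<close>). As \<open>B \<zeta>\<close> already exhausts all values, \<open>B\<close> is the commutant of \<open>Bd\<close>,
  and by symmetry \<open>Bd\<close> is the commutant of \<open>B\<close>; in particular both algebras contain the identity.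

  The rest of the argument compares values at \<open>\<zeta>\<close>. For each of the operator spaces \<open>V = Bd\<close> and
  \<open>V = \<alpha>\<close>, evaluation at \<open>\<zeta>\<close> is a linear bijection from \<open>V\<close> onto the target space, so an operator
  can be prescribed by giving its value at \<open>T \<zeta>\<close> as a linear function of \<open>T\<close> in \<open>V\<close>
  (\<open>linear_factor_through_evaluation\<close>).

  For the existence of the induced representation (\<open>induced_exists\<close>), the operator \<open>\<rho>\<^sub>\<alpha>(c)\<close> is
  prescribed by \<open>\<xi> \<zeta> \<mapsto> \<xi> c \<zeta>\<close>; it sends \<open>\<xi> \<omega>\<close> to \<open>\<xi> c \<omega>\<close> because \<open>\<omega> = b \<zeta>\<close> with \<open>b\<close> in \<open>B\<close>, where
  \<open>b\<close> commutes with \<open>c\<close> and \<open>\<xi> b\<close> lies in \<open>\<alpha>\<close>.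

  For the space of intertwiners of \<open>\<rho>\<close>, the rule \<open>c \<zeta> \<mapsto> \<rho>(c) \<eta>\<close> defines an intertwiner with value
  \<open>\<eta>\<close> at \<open>\<zeta>\<close>, for any \<open>\<eta>\<close> in \<open>H\<close> (\<open>\<L>_eval\<close>). This gives \<open>[\<L> h] = H\<close> and, together with the
  faithfulness of \<open>\<rho>\<close>, the equality \<open>[\<L>\<^sup>* \<L>] = B\<close> (\<open>B_eq_span_adj_\<L>\<close>).

  Finally, if \<open>\<rho>\<close> is the representation induced by \<open>\<alpha>\<close>, then \<open>\<alpha>\<close> consists of intertwiners and
  takes all values at \<open>\<zeta>\<close>, so it contains every intertwiner (\<open>induces_iff\<close>). Conversely,
  the intertwining relation says that \<open>\<rho>\<close> has the property that characterizes the representation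
  induced by \<open>\<L>\<close>.
\<close>

section \<open>Complex inner products and finite-dimensional Hilbert spaces\<close>

lemma cinner_add_left: "cinner (x + y) z = cinner x z + cinner y z"
  for x y z :: "'a::complex_inner"
  by (metis cinner_add_right cinner_commute complex_cnj_add)

lemma cinner_scaleC_left: "cinner (a *\<^sub>C x) y = cnj a * cinner x y"
  for x y :: "'a::complex_inner"
  by (metis cinner_commute cinner_scaleC_right complex_cnj_mult)

lemma cinner_zero_right [simp]: "cinner x 0 = 0"
  for x :: "'a::complex_inner"
  using cinner_add_right[of x 0 0] by simp

lemma cinner_zero_left [simp]: "cinner 0 x = 0"
  for x :: "'a::complex_inner"
  using cinner_add_left[of 0 0 x] by simp

lemma cinner_minus_right: "cinner x (- y) = - cinner x y"
  for x y :: "'a::complex_inner"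
  using cinner_add_right[of x y "- y"] by (simp add: eq_neg_iff_add_eq_0 add.commute)

lemma cinner_diff_right: "cinner x (y - z) = cinner x y - cinner x z"
  for x y z :: "'a::complex_inner"
  using cinner_add_right[of x y "- z"] by (simp add: cinner_minus_right)

lemma cinner_sum_right: "cinner x (\<Sum>i\<in>I. f i) = (\<Sum>i\<in>I. cinner x (f i))"
  for x :: "'a::complex_inner"
  by (induction I rule: infinite_finite_induct) (auto simp: cinner_add_right)

lemma cinner_sum_left: "cinner (\<Sum>i\<in>I. f i) x = (\<Sum>i\<in>I. cinner (f i) x)"
  for x :: "'a::complex_inner"
  by (induction I rule: infinite_finite_induct) (auto simp: cinner_add_left)

lemma cinner_self_eq_0 [simp]: "cinner x x = 0 \<longleftrightarrow> x = 0"
  for x :: "'a::complex_inner"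
  by (simp add: cinner_self)

lemma cinner_eqI: "(\<And>z. cinner z x = cinner z y) \<Longrightarrow> x = y"
  for x y :: "'a::complex_inner"
  using cinner_self_eq_0[of "x - y"] by (simp add: cinner_diff_right)

lemma cmod_cinner_le: "cmod (cinner x y) \<le> norm x * norm y"
  for x y :: "'a::complex_inner"
proof (cases "cinner x y = 0")
  case False
  \<comment> \<open>Rotating \<open>y\<close> by a phase makes the inner product real.\<close>
  define c where "c = cnj (cinner x y) / cmod (cinner x y)"
  have c: "cmod c = 1" using False by (simp add: c_def norm_divide)
  have "cinner x (c *\<^sub>C y) = cmod (cinner x y)"
    using False complex_norm_square[of "cinner x y"]
    by (simp add: cinner_scaleC_right c_def field_simps power2_eq_square)
  then have "cmod (cinner x y) = inner x (c *\<^sub>C y)" by (simp add: inner_cinner)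
  also have "\<dots> \<le> norm x * norm (c *\<^sub>C y)" by (rule norm_cauchy_schwarz)
  finally show ?thesis by (simp add: norm_scaleC c)
qed simp

lemma bounded_linear_cinner_right: "bounded_linear (cinner x)"
  for x :: "'a::complex_inner"
proof (rule bounded_linear_intro[where K = "norm x"])
  show "cinner x (r *\<^sub>R y) = r *\<^sub>R cinner x y" for r y
    by (simp add: scaleR_scaleC cinner_scaleC_right scaleR_conv_of_real)
  show "norm (cinner x y) \<le> norm y * norm x" for y
    using cmod_cinner_le[of x y] by (simp add: mult.commute)
qed (simp add: cinner_add_right)

lemma bounded_linear_scaleC_left: "bounded_linear (\<lambda>c. c *\<^sub>C y)"
  for y :: "'a::complex_normed_vector"
proof (rule bounded_linear_intro[where K = "norm y"])
  show "(r *\<^sub>R c) *\<^sub>C y = r *\<^sub>R (c *\<^sub>C y)" for r c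
    by (simp add: scaleR_scaleC scaleC_scaleC scaleR_conv_of_real)
qed (simp_all add: scaleC_add_left norm_scaleC)

lemma bounded_linear_rank_one: "bounded_linear (\<lambda>x. cinner e x *\<^sub>C y)"
  for e :: "'a::complex_inner" and y :: "'b::complex_normed_vector"
  using bounded_linear_compose[OF bounded_linear_scaleC_left bounded_linear_cinner_right] .

text \<open>
  A finite subset \<open>E\<close> is a Parseval frame of the set \<open>V\<close> when the rank-one operators given by
  its elements sum to the identity on \<open>V\<close>. Orthonormal bases are the frames that occur; the
  expansion of vectors is the only property of them that is used.
\<close>

definition parseval_frame :: "'a::complex_inner set \<Rightarrow> 'a set \<Rightarrow> bool" where
  "parseval_frame E V \<longleftrightarrow> finite E \<and> (\<forall>x\<in>V. (\<Sum>e\<in>E. cinner e x *\<^sub>C e) = x)"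

text \<open>Gram--Schmidt orthonormalization yields a Parseval frame of any finite span.\<close>

lemma parseval_frame_exists:
  fixes S :: "'a::complex_inner set"
  assumes "finite S"
  shows "\<exists>E. parseval_frame E (cspan S) \<and> E \<subseteq> cspan S"
proof -
  have "\<exists>E. finite E \<and> (\<forall>e\<in>E. \<forall>f\<in>E. cinner e f = (if e = f then 1 else 0)) \<and> cspan E = cspan S"
    using assms
  proof induction
    case empty
    show ?case by (intro exI[of _ "{}"]) simp
  next
    case (insert a S)
    then obtain E where E: "finite E" "cspan E = cspan S"
      and on: "\<And>e f. e \<in> E \<Longrightarrow> f \<in> E \<Longrightarrow> cinner e f = (if e = f then 1 else 0)"
      by blast
    define p where "p = (\<Sum>e\<in>E. cinner e a *\<^sub>C e)"
    have p: "p \<in> cspan E"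
      unfolding p_def
      by (intro complex_vector.span_sum complex_vector.span_scale complex_vector.span_base)
    have orth: "cinner f (a - p) = 0" if "f \<in> E" for f
    proof -
      have "cinner f p = (\<Sum>e\<in>E. if f = e then cinner f a else 0)"
        unfolding p_def cinner_sum_right
        by (intro sum.cong refl) (auto simp: cinner_scaleC_right on that)
      then show ?thesis using that E(1) by (simp add: cinner_diff_right)
    qed
    have ins: "cspan (insert a S) = cspan (insert a E)"
      using E(2) by (metis complex_vector.span_insert)
    show ?case
    proof (cases "a = p")
      case True
      then have "cspan (insert a E) = cspan E" using p complex_vector.span_redundant by blast
      then show ?thesis using E on ins by metis
    next
      case False
      define u where "u = complex_of_real (1 / norm (a - p)) *\<^sub>C (a - p)"
      have "norm u = 1" using False by (simp add: u_def norm_scaleC norm_divide)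
      then have uu: "cinner u u = 1" by (simp add: cinner_self)
      have uE: "cinner f u = 0" "cinner u f = 0" if "f \<in> E" for f
        using orth[OF that] cinner_commute[of "a - p" f]
        by (simp_all add: u_def cinner_scaleC_left cinner_scaleC_right)
      have "u \<notin> E" using uu uE by auto
      have a: "a = complex_of_real (norm (a - p)) *\<^sub>C u + p"
        using False by (simp add: u_def scaleC_scaleC scaleC_one flip: of_real_mult)
      have "a \<in> cspan (insert u E)"
        by (subst a, intro complex_vector.span_add complex_vector.span_scale)
          (use p complex_vector.span_mono[of E "insert u E"] in
            \<open>auto intro: complex_vector.span_base\<close>)
      moreover have "u \<in> cspan (insert a E)"
        unfolding u_def
        by (intro complex_vector.span_diff complex_vector.span_scale)
          (use p complex_vector.span_mono[of E "insert a E"] in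
            \<open>auto intro: complex_vector.span_base\<close>)
      ultimately have "cspan (insert u E) = cspan (insert a E)"
        unfolding complex_vector.span_eq
        by (auto intro: complex_vector.span_base)
      then show ?thesis
        using E on uu uE \<open>u \<notin> E\<close> ins by (intro exI[of _ "insert u E"]) auto
    qed
  qed
  then obtain E where E: "finite E" "cspan E = cspan S"
    and on: "\<And>e f. e \<in> E \<Longrightarrow> f \<in> E \<Longrightarrow> cinner e f = (if e = f then 1 else 0)"
    by blast
  have "(\<Sum>e\<in>E. cinner e x *\<^sub>C e) = x" if "x \<in> cspan E" for x
    using that
  proof (induction rule: complex_vector.span_induct_alt)
    case base
    show ?case by simp
  next
    case (step c f y)
    have "(\<Sum>e\<in>E. (c * cinner e f) *\<^sub>C e) = (\<Sum>e\<in>E. if f = e then c *\<^sub>C f else 0)"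
      by (intro sum.cong refl) (auto simp: on step)
    then show ?case
      using step E(1)
      by (simp add: cinner_add_right cinner_scaleC_right scaleC_add_left sum.distrib)
  qed
  then show ?thesis
    unfolding parseval_frame_def using E complex_vector.span_superset by blast
qed

lemma subspace_finite_span:
  fixes S V :: "'a::complex_vector set"
  assumes "finite S" "csubspace V" "V \<subseteq> cspan S"
  obtains S' where "finite S'" "S' \<subseteq> V" "cspan S' = V"
proof -
  obtain S' where S': "S' \<subseteq> V" "\<not> complex_vector.dependent S'" "V \<subseteq> cspan S'"
    using complex_vector.basis_exists[of V] by metis
  then have "finite S'"
    using complex_vector.independent_span_bound[OF assms(1), of S'] assms(3) by blast
  moreover have "cspan S' = V"
    using S' complex_vector.span_minimal[OF S'(1) assms(2)] by blast
  ultimately show ?thesis using that S'(1) by blast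
qed

lemma subspace_parseval_frame:
  fixes S V :: "'a::complex_inner set"
  assumes "finite S" "csubspace V" "V \<subseteq> cspan S"
  obtains E where "E \<subseteq> V" "parseval_frame E V"
  using subspace_finite_span[OF assms] parseval_frame_exists by metis

lemma parseval_frame_sum_in:
  assumes "csubspace V" "E \<subseteq> V"
  shows "(\<Sum>e\<in>E. f e *\<^sub>C e) \<in> V"
  using assms
  by (intro complex_vector.subspace_sum complex_vector.subspace_scale) auto

lemma closed_finite_dim_subspace:
  fixes S V :: "'a::complex_inner set"
  assumes "finite S" "csubspace V" "V \<subseteq> cspan S"
  shows "closed V"
proof -
  obtain E where E: "E \<subseteq> V" "parseval_frame E V" by (rule subspace_parseval_frame[OF assms])
  have "x \<in> V" if "(\<Sum>e\<in>E. cinner e x *\<^sub>C e) = x" for x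
    using parseval_frame_sum_in[OF assms(2) E(1), of "\<lambda>e. cinner e x"] that by simp
  then have "V = {x. (\<Sum>e\<in>E. cinner e x *\<^sub>C e) = x}"
    using E(2) by (auto simp: parseval_frame_def)
  also have "closed \<dots>"
    by (intro closed_Collect_eq continuous_on_sum continuous_on_id
        linear_continuous_on bounded_linear_rank_one)
  finally show ?thesis .
qed

lemma finite_dim_subspace_UNIV:
  fixes S V :: "'a::complex_inner set"
  assumes "finite S" "cspan S = UNIV" "csubspace V"
    and orth: "\<And>x. (\<And>v. v \<in> V \<Longrightarrow> cinner v x = 0) \<Longrightarrow> x = 0"
  shows "V = UNIV"
proof -
  obtain E where E: "E \<subseteq> V" "parseval_frame E V"
    using subspace_parseval_frame[OF assms(1,3)] assms(2) by blast
  have "x \<in> V" for x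
  proof -
    define p where "p = (\<Sum>e\<in>E. cinner e x *\<^sub>C e)"
    have "p \<in> V" unfolding p_def by (rule parseval_frame_sum_in[OF assms(3) E(1)])
    have "cinner v (x - p) = 0" if "v \<in> V" for v
    proof -
      have "cinner v x = cinner (\<Sum>e\<in>E. cinner e v *\<^sub>C e) x"
        using E that by (simp add: parseval_frame_def)
      also have "\<dots> = (\<Sum>e\<in>E. cinner e x * cinner v e)"
        unfolding cinner_sum_left
        by (intro sum.cong refl) (metis cinner_commute cinner_scaleC_left mult.commute)
      also have "\<dots> = cinner v p"
        by (simp add: p_def cinner_sum_right cinner_scaleC_right)
      finally show ?thesis by (simp add: cinner_diff_right)
    qed
    then show ?thesis using orth[of "x - p"] \<open>p \<in> V\<close> by simp
  qed
  then show ?thesis by blast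
qed

section \<open>Closed spans and bounded operators\<close>

lemma closed_cspan_minimal:
  "Y \<subseteq> V \<Longrightarrow> csubspace V \<Longrightarrow> closed V \<Longrightarrow> closed_cspan Y \<subseteq> V"
  unfolding closed_cspan_def by (intro closure_minimal complex_vector.span_minimal)

lemma cspan_subset_closed_cspan: "cspan Y \<subseteq> closed_cspan Y"
  unfolding closed_cspan_def by (rule closure_subset)

lemma subset_closed_cspan: "Y \<subseteq> closed_cspan Y"
  using cspan_subset_closed_cspan complex_vector.span_superset by blast

lemma clinear_opsD: "T \<in> clinear_ops \<Longrightarrow> blinfun_apply T (c *\<^sub>C x) = c *\<^sub>C blinfun_apply T x"
  by (simp add: clinear_ops_def)

lemma total_clinear_ops_eqI:
  assumes "closed_cspan Y = UNIV" "S \<in> clinear_ops" "T \<in> clinear_ops"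
    and "\<And>y. y \<in> Y \<Longrightarrow> blinfun_apply S y = blinfun_apply T y"
  shows "S = T"
proof -
  have "closed_cspan Y \<subseteq> {z. blinfun_apply S z = blinfun_apply T z}"
    using assms
    by (intro closed_cspan_minimal)
      (auto simp: complex_vector.subspace_def blinfun.add_right clinear_opsD
        blinfun.zero_right intro!: closed_Collect_eq continuous_intros)
  then show ?thesis using assms(1) by (intro blinfun_eqI) blast
qed

lemma id_blinfun_clinear [simp]: "id_blinfun \<in> clinear_ops"
  by (simp add: clinear_ops_def)

lemma compose_clinear_ops: "S \<in> clinear_ops \<Longrightarrow> T \<in> clinear_ops \<Longrightarrow> S o\<^sub>L T \<in> clinear_ops"
  by (simp add: clinear_ops_def)

lemma csubspace_clinear_ops: "csubspace clinear_ops"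
  by (auto simp: complex_vector.subspace_def clinear_ops_def blinfun.add_left scaleC_add_right
      scaleC_blinfun.rep_eq scaleC_scaleC mult.commute)

lemma bounded_linear_scaleC_right:
  "bounded_linear (\<lambda>x::'a::complex_normed_vector. c *\<^sub>C x)"
  by (rule bounded_linear_intro[where K = "cmod c"])
    (simp_all add: scaleC_add_right scaleR_scaleC scaleC_scaleC norm_scaleC mult.commute)

lemma closed_clinear_ops:
  "closed (clinear_ops :: ('a::complex_normed_vector \<Rightarrow>\<^sub>L 'b::complex_normed_vector) set)"
  unfolding clinear_ops_def
  by (intro closed_Collect_all closed_Collect_eq continuous_intros
      bounded_linear.continuous_on[OF bounded_linear_scaleC_right])

lemma op_images_singleton: "op_images V {x} = (\<lambda>T. blinfun_apply T x) ` V"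
  by (auto simp: op_images_def)

lemma csubspace_eval:
  assumes "csubspace V"
  shows "csubspace ((\<lambda>T. blinfun_apply T x) ` V)"
proof (rule complex_vector.subspaceI)
  show "0 \<in> (\<lambda>T. blinfun_apply T x) ` V"
    using complex_vector.subspace_0[OF assms] by (rule rev_image_eqI) simp
next
  fix v w c
  assume "v \<in> (\<lambda>T. blinfun_apply T x) ` V"
  then obtain T where T: "T \<in> V" "v = blinfun_apply T x" by blast
  show "c *\<^sub>C v \<in> (\<lambda>T. blinfun_apply T x) ` V"
    using complex_vector.subspace_scale[OF assms T(1), of c]
    by (rule rev_image_eqI) (simp add: T(2) scaleC_blinfun.rep_eq)
  assume "w \<in> (\<lambda>T. blinfun_apply T x) ` V"
  then obtain S where S: "S \<in> V" "w = blinfun_apply S x" by blast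
  show "v + w \<in> (\<lambda>T. blinfun_apply T x) ` V"
    using complex_vector.subspace_add[OF assms T(1) S(1)]
    by (rule rev_image_eqI) (simp add: T(2) S(2) blinfun.add_left)
qed

text \<open>In finite dimensions every complex-linear map is bounded.\<close>

lemma finite_dim_linear_blinfun:
  fixes f :: "'a::complex_inner \<Rightarrow> 'b::complex_normed_vector"
  assumes "parseval_frame E (UNIV :: 'a set)" "\<And>x y. f (x + y) = f x + f y"
    "\<And>c x. f (c *\<^sub>C x) = c *\<^sub>C f x"
  obtains T where "T \<in> clinear_ops" "blinfun_apply T = f"
proof -
  have f0: "f 0 = 0" using assms(2)[of 0 0] by simp
  have sum: "f (\<Sum>i\<in>I. g i) = (\<Sum>i\<in>I. f (g i))" for g :: "'a \<Rightarrow> 'a" and I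
    by (induction I rule: infinite_finite_induct) (auto simp: f0 assms(2))
  have "f x = (\<Sum>e\<in>E. cinner e x *\<^sub>C f e)" for x
    using sum[of "\<lambda>e. cinner e x *\<^sub>C e" E] assms(1,3) by (simp add: parseval_frame_def)
  then have "f = (\<lambda>x. \<Sum>e\<in>E. cinner e x *\<^sub>C f e)" by blast
  moreover have "bounded_linear (\<lambda>x. \<Sum>e\<in>E. cinner e x *\<^sub>C f e)"
    by (intro bounded_linear_sum bounded_linear_rank_one)
  ultimately have "bounded_linear f" by simp
  then have "blinfun_apply (Blinfun f) = f" by (rule bounded_linear_Blinfun_apply)
  then show ?thesis using that[of "Blinfun f"] assms(3) by (simp add: clinear_ops_def)
qed

lemma adj_unique:
  assumes "\<And>x y. cinner (blinfun_apply S y) x = cinner y (blinfun_apply T x)"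
  shows "adj T = S"
  unfolding adj_def
proof (rule the_equality)
  fix R assume R: "\<forall>x y. cinner (blinfun_apply R y) x = cinner y (blinfun_apply T x)"
  show "R = S"
  proof (intro blinfun_eqI cinner_eqI)
    fix y z
    show "cinner z (blinfun_apply R y) = cinner z (blinfun_apply S y)"
      using R assms cinner_commute by metis
  qed
qed (use assms in blast)

lemma cinner_adj:
  fixes T :: "'a::complex_hilbert \<Rightarrow>\<^sub>L 'b::complex_hilbert"
  assumes E: "parseval_frame E (UNIV :: 'a set)" and T: "T \<in> clinear_ops"
  shows "cinner (blinfun_apply (adj T) y) x = cinner y (blinfun_apply T x)"
proof -
  define f where "f y = (\<Sum>e\<in>E. cinner (blinfun_apply T e) y *\<^sub>C e)" for y
  have "bounded_linear f"
    unfolding f_def by (intro bounded_linear_sum bounded_linear_rank_one)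
  then have f: "blinfun_apply (Blinfun f) = f" by (rule bounded_linear_Blinfun_apply)
  have f_adj: "cinner (f y) x = cinner y (blinfun_apply T x)" for x y
  proof -
    have "cinner (f y) x = (\<Sum>e\<in>E. cinner y (cinner e x *\<^sub>C blinfun_apply T e))"
      unfolding f_def cinner_sum_left
      by (intro sum.cong refl)
        (metis cinner_commute cinner_scaleC_left cinner_scaleC_right mult.commute)
    also have "\<dots> = cinner y (blinfun_apply T (\<Sum>e\<in>E. cinner e x *\<^sub>C e))"
      by (simp add: cinner_sum_right blinfun.sum_right clinear_opsD[OF T])
    also have "\<dots> = cinner y (blinfun_apply T x)" using E by (simp add: parseval_frame_def)
    finally show ?thesis .
  qed
  then have "adj T = Blinfun f" by (intro adj_unique) (simp add: f)
  then show ?thesis by (simp add: f f_adj)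
qed

lemma clinear_ops_finite_dim:
  assumes E: "parseval_frame E (UNIV :: 'a::complex_inner set)"
    and F: "parseval_frame F (UNIV :: 'b::complex_inner set)"
  obtains S where "finite S" "(clinear_ops :: ('a \<Rightarrow>\<^sub>L 'b) set) \<subseteq> cspan S"
proof -
  define \<Theta> :: "'b \<Rightarrow> 'a \<Rightarrow> 'a \<Rightarrow>\<^sub>L 'b" where "\<Theta> y e = Blinfun (\<lambda>x. cinner e x *\<^sub>C y)" for y e
  have \<Theta>: "blinfun_apply (\<Theta> y e) x = cinner e x *\<^sub>C y" for y e x
    unfolding \<Theta>_def by (simp add: bounded_linear_Blinfun_apply[OF bounded_linear_rank_one])
  define S where "S = (\<lambda>(y, e). \<Theta> y e) ` (F \<times> E)"
  have "T \<in> cspan S" if T: "T \<in> clinear_ops" for T :: "'a \<Rightarrow>\<^sub>L 'b"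
  proof -
    have "T = (\<Sum>e\<in>E. \<Sum>y\<in>F. cinner y (blinfun_apply T e) *\<^sub>C \<Theta> y e)"
    proof (rule blinfun_eqI)
      fix x
      have "blinfun_apply T x = blinfun_apply T (\<Sum>e\<in>E. cinner e x *\<^sub>C e)"
        using E by (simp add: parseval_frame_def)
      also have "\<dots> = (\<Sum>e\<in>E. cinner e x *\<^sub>C (\<Sum>y\<in>F. cinner y (blinfun_apply T e) *\<^sub>C y))"
        using F by (simp add: parseval_frame_def blinfun.sum_right clinear_opsD[OF T])
      also have "\<dots> = blinfun_apply (\<Sum>e\<in>E. \<Sum>y\<in>F. cinner y (blinfun_apply T e) *\<^sub>C \<Theta> y e) x"
        by (simp add: blinfun.sum_left scaleC_blinfun.rep_eq \<Theta> scaleC_scaleC mult.commute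
            complex_vector.scale_sum_right)
      finally show "blinfun_apply T x =
        blinfun_apply (\<Sum>e\<in>E. \<Sum>y\<in>F. cinner y (blinfun_apply T e) *\<^sub>C \<Theta> y e) x" .
    qed
    also have "\<dots> \<in> cspan S"
      by (intro complex_vector.span_sum complex_vector.span_scale complex_vector.span_base)
        (auto simp: S_def)
    finally show ?thesis .
  qed
  moreover have "finite S" using E F by (simp add: S_def parseval_frame_def)
  ultimately show ?thesis using that by blast
qed

text \<open>
  If evaluation at \<open>\<zeta>\<close> identifies a space \<open>V\<close> of operators with the whole finite-dimensional
  target, then every linear map on \<open>V\<close> becomes a bounded operator on that target.
\<close>

lemma linear_factor_through_evaluation:
  fixes V :: "('a::complex_normed_vector \<Rightarrow>\<^sub>L 'b::complex_inner) set"
    and F :: "('a \<Rightarrow>\<^sub>L 'b) \<Rightarrow> 'c::complex_normed_vector"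
  assumes E: "parseval_frame E (UNIV :: 'b set)" and V: "csubspace V"
    and inj: "\<And>T. T \<in> V \<Longrightarrow> blinfun_apply T \<zeta> = 0 \<Longrightarrow> T = 0"
    and surj: "\<And>x. \<exists>T\<in>V. blinfun_apply T \<zeta> = x"
    and add: "\<And>S T. S \<in> V \<Longrightarrow> T \<in> V \<Longrightarrow> F (S + T) = F S + F T"
    and scale: "\<And>c T. T \<in> V \<Longrightarrow> F (c *\<^sub>C T) = c *\<^sub>C F T"
  obtains G where "G \<in> clinear_ops" "\<And>T. T \<in> V \<Longrightarrow> blinfun_apply G (blinfun_apply T \<zeta>) = F T"
proof -
  obtain L where L: "\<And>x. L x \<in> V" "\<And>x. blinfun_apply (L x) \<zeta> = x" using surj by metis
  have eq: "S = T" if "S \<in> V" "T \<in> V" "blinfun_apply S \<zeta> = blinfun_apply T \<zeta>" for S T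
    using inj[of "S - T"] complex_vector.subspace_diff[OF V that(1,2)] that(3)
    by (simp add: blinfun.diff_left)
  have L_eval: "L (blinfun_apply T \<zeta>) = T" if "T \<in> V" for T
    using eq L that by metis
  have "L (x + y) = L x + L y" for x y
    by (intro eq complex_vector.subspace_add[OF V] L(1)) (simp add: L(2) blinfun.add_left)
  then have F_add: "F (L (x + y)) = F (L x) + F (L y)" for x y by (simp add: add L(1))
  have "L (c *\<^sub>C x) = c *\<^sub>C L x" for c x
    by (intro eq complex_vector.subspace_scale[OF V] L(1)) (simp add: L(2) scaleC_blinfun.rep_eq)
  then have F_scale: "F (L (c *\<^sub>C x)) = c *\<^sub>C F (L x)" for c x by (simp add: scale L(1))
  obtain G where "G \<in> clinear_ops" "blinfun_apply G = (\<lambda>x. F (L x))"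
    by (rule finite_dim_linear_blinfun[OF E F_add F_scale])
  then show ?thesis using that L_eval by simp
qed

lemma parseval_frame_cspan:
  assumes "parseval_frame E UNIV"
  shows "finite E" "cspan E = UNIV"
proof -
  show "finite E" using assms by (simp add: parseval_frame_def)
  have "x \<in> cspan E" for x
    using parseval_frame_sum_in[OF complex_vector.subspace_span complex_vector.span_superset,
        of "\<lambda>e. cinner e x" E] assms
    by (simp add: parseval_frame_def)
  then show "cspan E = UNIV" by blast
qed

text \<open>
  An operator that intertwines a set of operators acting transitively on \<open>\<zeta>\<close> is determined by
  its value at \<open>\<zeta>\<close>.
\<close>

lemma intertwiner_eqI:
  assumes surj: "\<And>x. \<exists>a\<in>A. blinfun_apply a \<zeta> = x"
    and S: "\<And>a. a \<in> A \<Longrightarrow> S o\<^sub>L a = R a o\<^sub>L S"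
    and T: "\<And>a. a \<in> A \<Longrightarrow> T o\<^sub>L a = R a o\<^sub>L T"
    and "blinfun_apply S \<zeta> = blinfun_apply T \<zeta>"
  shows "S = T"
proof (rule blinfun_eqI)
  fix x
  obtain a where a: "a \<in> A" "blinfun_apply a \<zeta> = x" using surj by blast
  then show "blinfun_apply S x = blinfun_apply T x"
    using S[OF a(1)] T[OF a(1)] assms(4) by (metis blinfun_apply_blinfun_compose)
qed

section \<open>Standard bases in finite dimensions\<close>

text \<open>
  A space of operators that embeds into the operators on a finite-dimensional space is finite
  dimensional, so a cyclic vector of it generates the Hilbert space without passing to a closure.
\<close>

lemma finite_dim_if_cyclic:
  fixes A :: "('h::complex_hilbert \<Rightarrow>\<^sub>L 'h) set"
    and \<rho> :: "('h \<Rightarrow>\<^sub>L 'h) \<Rightarrow> ('k::complex_hilbert \<Rightarrow>\<^sub>L 'k)"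
  assumes K: "parseval_frame K (UNIV :: 'k set)"
    and A: "csubspace A"
    and rep: "representation A \<rho>" and inj: "inj_on \<rho> A"
    and cyc: "cyclic A \<zeta>"
  obtains E where "parseval_frame E (UNIV :: 'h set)"
proof -
  have clin: "\<rho> ` A \<subseteq> clinear_ops"
    and add: "\<And>S T. S \<in> A \<Longrightarrow> T \<in> A \<Longrightarrow> \<rho> (S + T) = \<rho> S + \<rho> T"
    and scale: "\<And>c T. T \<in> A \<Longrightarrow> \<rho> (c *\<^sub>C T) = c *\<^sub>C \<rho> T"
    using rep by (auto simp: representation_def)
  have image: "csubspace (\<rho> ` V)" if V: "csubspace V" "V \<subseteq> A" for V
  proof (rule complex_vector.subspaceI)
    have "\<rho> 0 = 0" using scale[of 0 0] complex_vector.subspace_0[OF A] by simp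
    then show "0 \<in> \<rho> ` V" using complex_vector.subspace_0[OF V(1)] by force
  next
    fix x y c assume "x \<in> \<rho> ` V"
    then obtain S where S: "S \<in> V" "x = \<rho> S" by blast
    show "c *\<^sub>C x \<in> \<rho> ` V"
      using complex_vector.subspace_scale[OF V(1) S(1), of c] by (rule rev_image_eqI)
        (use S V(2) scale in auto)
    assume "y \<in> \<rho> ` V"
    then obtain T where T: "T \<in> V" "y = \<rho> T" by blast
    show "x + y \<in> \<rho> ` V"
      using complex_vector.subspace_add[OF V(1) S(1) T(1)] by (rule rev_image_eqI)
        (use S T V(2) in \<open>simp add: add subset_iff\<close>)
  qed
  obtain C :: "('k \<Rightarrow>\<^sub>L 'k) set" where C: "finite C" "clinear_ops \<subseteq> cspan C"
    by (rule clinear_ops_finite_dim[OF K K])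
  obtain S where S: "finite S" "S \<subseteq> \<rho> ` A" "cspan S = \<rho> ` A"
    by (rule subspace_finite_span[OF C(1) image[OF A order_refl] subset_trans[OF clin C(2)]])
  obtain D where D: "finite D" "D \<subseteq> A" "S = \<rho> ` D"
    using finite_subset_image[OF S(1,2)] by metis
  have DA: "cspan D \<subseteq> A" by (rule complex_vector.span_minimal[OF D(2) A])
  \<comment> \<open>A finite set spanning the image of \<open>A\<close> lifts to a finite set spanning \<open>A\<close>.\<close>
  have "cspan (\<rho> ` D) \<subseteq> \<rho> ` cspan D"
    by (rule complex_vector.span_minimal[OF image_mono[OF complex_vector.span_superset]
        image[OF complex_vector.subspace_span DA]])
  then have "\<rho> ` A = \<rho> ` cspan D" using S(3) D(3) DA by (metis image_mono subset_antisym)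
  then have "A = cspan D" using inj_on_image_eq_iff[OF inj order_refl DA] by blast
  define Z where "Z = (\<lambda>T. blinfun_apply T \<zeta>) ` D"
  have Z: "finite Z" using D(1) by (simp add: Z_def)
  have "blinfun_apply T \<zeta> \<in> cspan Z" if "T \<in> cspan D" for T
    using that
  proof (induction rule: complex_vector.span_induct_alt)
    case base
    show ?case by (simp add: complex_vector.span_zero)
  next
    case (step c T U)
    then have "blinfun_apply T \<zeta> \<in> cspan Z"
      by (intro complex_vector.span_base) (simp add: Z_def)
    then show ?case
      using complex_vector.span_add[OF complex_vector.span_scale step(2)]
      by (simp add: blinfun.add_left scaleC_blinfun.rep_eq)
  qed
  then have "op_images A {\<zeta>} \<subseteq> cspan Z"
    using \<open>A = cspan D\<close> by (auto simp: op_images_singleton)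
  then have "closed_cspan (op_images A {\<zeta>}) \<subseteq> cspan Z"
    by (rule closed_cspan_minimal[OF _ complex_vector.subspace_span
        closed_finite_dim_subspace[OF Z complex_vector.subspace_span order_refl]])
  then have "cspan Z = UNIV" using cyc by (auto simp: cyclic_def)
  then show ?thesis using parseval_frame_exists[OF Z] that by metis
qed

lemma cyclic_finite_dim:
  fixes A :: "('h::complex_hilbert \<Rightarrow>\<^sub>L 'h) set"
  assumes E: "parseval_frame E (UNIV :: 'h set)" and A: "csubspace A" and "cyclic A \<zeta>"
  shows "\<exists>a\<in>A. blinfun_apply a \<zeta> = x"
proof -
  have "closed_cspan (op_images A {\<zeta>}) \<subseteq> op_images A {\<zeta>}"
    unfolding op_images_singleton using parseval_frame_cspan[OF E]
    by (intro closed_cspan_minimal closed_finite_dim_subspace csubspace_eval A) auto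
  then have "x \<in> op_images A {\<zeta>}" using assms(3) by (auto simp: cyclic_def)
  then show ?thesis by (auto simp: op_images_singleton)
qed

text \<open>
  A standard base on a finite-dimensional Hilbert space; the frame \<open>E\<close> only witnesses the finite
  dimension, and \<open>B_eval\<close> and \<open>Bd_eval\<close> are the closure-free form of cyclicity. The
  bicyclic vector \<open>\<zeta>\<close> is separating for both algebras, and each of them is the commutant of the
  other.
\<close>

locale finite_standard_base =
  fixes B Bd :: "('h::complex_hilbert \<Rightarrow>\<^sub>L 'h) set" and \<zeta> :: 'h and E :: "'h set"
  assumes frame: "parseval_frame E UNIV"
    and B: "cstar_algebra B" and Bd: "cstar_algebra Bd"
    and commute: "\<And>b c. b \<in> B \<Longrightarrow> c \<in> Bd \<Longrightarrow> b o\<^sub>L c = c o\<^sub>L b"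
    and B_eval: "\<And>x. \<exists>b\<in>B. blinfun_apply b \<zeta> = x"
    and Bd_eval: "\<And>x. \<exists>c\<in>Bd. blinfun_apply c \<zeta> = x"
begin

lemma swap: "finite_standard_base Bd B \<zeta> E"
  using frame B Bd commute B_eval Bd_eval by unfold_locales auto

lemma in_B_if_commutes:
  assumes "\<And>c. c \<in> Bd \<Longrightarrow> T o\<^sub>L c = c o\<^sub>L T"
  shows "T \<in> B"
proof -
  obtain b where b: "b \<in> B" "blinfun_apply b \<zeta> = blinfun_apply T \<zeta>" using B_eval by blast
  have "b = T"
    by (rule intertwiner_eqI[OF Bd_eval, where R = "\<lambda>c. c"]) (use b commute assms in auto)
  then show ?thesis using b by simp
qed

lemma id_in_B: "id_blinfun \<in> B"
  by (rule in_B_if_commutes) (simp add: blinfun_eqI)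

lemmas in_Bd_if_commutes = finite_standard_base.in_B_if_commutes[OF swap]
lemmas id_in_Bd = finite_standard_base.id_in_B[OF swap]

lemma commute_apply:
  "b \<in> B \<Longrightarrow> c \<in> Bd \<Longrightarrow> blinfun_apply b (blinfun_apply c x) = blinfun_apply c (blinfun_apply b x)"
  using commute[of b c] by (metis blinfun_apply_blinfun_compose)

lemma B_separating:
  assumes "b \<in> B" "blinfun_apply b \<zeta> = 0"
  shows "b = 0"
  by (rule intertwiner_eqI[OF Bd_eval, where R = "\<lambda>c. c"])
    (use assms commute in \<open>auto intro: blinfun_eqI simp: blinfun.zero_left blinfun.zero_right\<close>)

lemmas Bd_separating = finite_standard_base.B_separating[OF swap]

lemma B_simps:
  shows B_clinear: "b \<in> B \<Longrightarrow> b \<in> clinear_ops"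
    and B_subspace: "csubspace B"
    and B_closed: "closed B"
    and B_compose: "b \<in> B \<Longrightarrow> c \<in> B \<Longrightarrow> b o\<^sub>L c \<in> B"
    and B_adj: "b \<in> B \<Longrightarrow> adj b \<in> B"
  using B by (auto simp: cstar_algebra_def)

lemmas Bd_clinear = finite_standard_base.B_clinear[OF swap]
  and Bd_subspace = finite_standard_base.B_subspace[OF swap]
  and Bd_compose = finite_standard_base.B_compose[OF swap]
  and Bd_adj = finite_standard_base.B_adj[OF swap]

lemma cinner_adj_left:
  "T \<in> clinear_ops \<Longrightarrow> cinner (blinfun_apply (adj T) y) x = cinner y (blinfun_apply T x)"
  for T :: "'h \<Rightarrow>\<^sub>L 'b::complex_hilbert"
  by (rule cinner_adj[OF frame])

lemma cinner_adj_right: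
  "T \<in> clinear_ops \<Longrightarrow> cinner x (blinfun_apply (adj T) y) = cinner (blinfun_apply T x) y"
  for T :: "'h \<Rightarrow>\<^sub>L 'b::complex_hilbert"
  by (metis cinner_adj_left cinner_commute)

end

section \<open>The representation induced by a factorization\<close>

text \<open>
  A factorization \<open>\<alpha>\<close> of a finite-dimensional space, with frame \<open>K\<close>, over a finite-dimensional
  standard base.
\<close>

locale finite_factorization = finite_standard_base B Bd \<zeta> E
  for B Bd :: "('h::complex_hilbert \<Rightarrow>\<^sub>L 'h) set" and \<zeta> E +
  fixes K :: "'k::complex_hilbert set" and \<alpha> :: "('h \<Rightarrow>\<^sub>L 'k) set"
  assumes frameK: "parseval_frame K UNIV"
    and factorization: "cstar_factorization B Bd \<alpha>"
begin

lemma factorization_simps: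
  shows clinear: "\<xi> \<in> \<alpha> \<Longrightarrow> \<xi> \<in> clinear_ops"
    and subspace: "csubspace \<alpha>"
    and total: "closed_cspan (op_images \<alpha> UNIV) = UNIV"
    and adj_compose: "\<eta> \<in> \<alpha> \<Longrightarrow> \<xi> \<in> \<alpha> \<Longrightarrow> adj \<eta> o\<^sub>L \<xi> \<in> B"
    and compose: "\<xi> \<in> \<alpha> \<Longrightarrow> b \<in> B \<Longrightarrow> \<xi> o\<^sub>L b \<in> \<alpha>"
proof -
  have "op_products (adj ` \<alpha>) \<alpha> \<subseteq> B" "op_products \<alpha> B \<subseteq> \<alpha>"
    using factorization subset_closed_cspan unfolding cstar_factorization_def by blast+
  then show "\<eta> \<in> \<alpha> \<Longrightarrow> \<xi> \<in> \<alpha> \<Longrightarrow> adj \<eta> o\<^sub>L \<xi> \<in> B" "\<xi> \<in> \<alpha> \<Longrightarrow> b \<in> B \<Longrightarrow> \<xi> o\<^sub>L b \<in> \<alpha>"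
    by (auto simp: op_products_def)
qed (use factorization in \<open>auto simp: cstar_factorization_def\<close>)

lemma eval: "\<exists>\<xi>\<in>\<alpha>. blinfun_apply \<xi> \<zeta> = x"
proof -
  define V where "V = (\<lambda>\<xi>. blinfun_apply \<xi> \<zeta>) ` \<alpha>"
  have "blinfun_apply \<xi> \<omega> \<in> V" if \<xi>: "\<xi> \<in> \<alpha>" for \<xi> \<omega>
  proof -
    obtain b where b: "b \<in> B" "blinfun_apply b \<zeta> = \<omega>" using B_eval by blast
    show ?thesis unfolding V_def
      using compose[OF \<xi> b(1)] by (rule rev_image_eqI) (simp add: b(2))
  qed
  then have "op_images \<alpha> UNIV \<subseteq> V" by (auto simp: op_images_def)
  moreover have "csubspace V" unfolding V_def by (intro csubspace_eval subspace)
  ultimately have "closed_cspan (op_images \<alpha> UNIV) \<subseteq> V"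
    using parseval_frame_cspan[OF frameK]
    by (intro closed_cspan_minimal closed_finite_dim_subspace[of K]) auto
  then have "x \<in> V" using total by blast
  then show ?thesis by (auto simp: V_def)
qed

text \<open>
  Moving \<open>c\<close> across the inner product of \<open>\<eta> v\<close> and \<open>\<xi> c w\<close> uses that \<open>\<eta>\<^sup>* \<xi>\<close> lies in \<open>B\<close> and so
  commutes with \<open>c\<close>. This is what makes \<open>\<rho>\<^sub>\<alpha>\<close> well defined and compatible with adjoints.
\<close>

lemma cinner_shift:
  assumes "\<xi> \<in> \<alpha>" "\<eta> \<in> \<alpha>" "c \<in> Bd"
  shows "cinner (blinfun_apply \<eta> v) (blinfun_apply \<xi> (blinfun_apply c w)) =
    cinner (blinfun_apply \<eta> (blinfun_apply (adj c) v)) (blinfun_apply \<xi> w)"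
proof -
  have "cinner (blinfun_apply \<eta> v) (blinfun_apply \<xi> (blinfun_apply c w)) =
      cinner v (blinfun_apply (adj \<eta> o\<^sub>L \<xi>) (blinfun_apply c w))"
    using clinear assms by (simp add: cinner_adj_right)
  also have "\<dots> = cinner v (blinfun_apply c (blinfun_apply (adj \<eta> o\<^sub>L \<xi>) w))"
    using adj_compose[OF assms(2,1)] assms(3) by (simp only: commute_apply)
  also have "\<dots> = cinner (blinfun_apply \<eta> (blinfun_apply (adj c) v)) (blinfun_apply \<xi> w)"
    using clinear Bd_clinear assms by (simp add: cinner_adj_right cinner_adj_left[symmetric])
  finally show ?thesis .
qed

lemma separating:
  assumes "\<xi> \<in> \<alpha>" "blinfun_apply \<xi> \<zeta> = 0"
  shows "\<xi> = 0"
proof (rule blinfun_eqI)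
  fix x
  obtain c where c: "c \<in> Bd" "blinfun_apply c \<zeta> = x" using Bd_eval by blast
  have "cinner (blinfun_apply \<xi> x) (blinfun_apply \<xi> x) = 0"
    using cinner_shift[OF assms(1,1) c(1), of x \<zeta>] c(2) assms(2) by simp
  then show "blinfun_apply \<xi> x = blinfun_apply 0 x" by (simp add: blinfun.zero_left)
qed

lemma induced_unique:
  assumes "induces_representation Bd \<alpha> \<sigma>" "induces_representation Bd \<alpha> \<tau>"
  shows "\<sigma> = \<tau>"
proof (rule PiE_ext)
  show "\<sigma> \<in> Bd \<rightarrow>\<^sub>E clinear_ops" "\<tau> \<in> Bd \<rightarrow>\<^sub>E clinear_ops"
    using assms
    by (auto simp: induces_representation_def nondegenerate_faithful_representation_def
        representation_def)
  then show "\<sigma> c = \<tau> c" if "c \<in> Bd" for c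
    using assms that
    by (intro total_clinear_ops_eqI[OF total])
      (auto simp: induces_representation_def op_images_def)
qed

lemma induced_exists: "\<exists>\<sigma>. induces_representation Bd \<alpha> \<sigma>"
proof -
  have "\<exists>G\<in>clinear_ops. \<forall>\<xi>\<in>\<alpha>.
      blinfun_apply G (blinfun_apply \<xi> \<zeta>) = blinfun_apply \<xi> (blinfun_apply c \<zeta>)" for c
    by (rule linear_factor_through_evaluation[OF frameK subspace separating eval,
          where F = "\<lambda>\<xi>. blinfun_apply \<xi> (blinfun_apply c \<zeta>)"])
      (auto simp: blinfun.add_left scaleC_blinfun.rep_eq)
  then obtain G where G: "\<And>c. G c \<in> clinear_ops"
    and G_eval: "\<And>c \<xi>. \<xi> \<in> \<alpha> \<Longrightarrow>
      blinfun_apply (G c) (blinfun_apply \<xi> \<zeta>) = blinfun_apply \<xi> (blinfun_apply c \<zeta>)"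
    by metis
  define \<sigma> where "\<sigma> = restrict G Bd"
  have clin: "\<sigma> c \<in> clinear_ops" if "c \<in> Bd" for c using G that by (simp add: \<sigma>_def)
  have \<sigma>: "blinfun_apply (\<sigma> c) (blinfun_apply \<xi> \<omega>) = blinfun_apply \<xi> (blinfun_apply c \<omega>)"
    if c: "c \<in> Bd" and \<xi>: "\<xi> \<in> \<alpha>" for c \<xi> \<omega>
  proof -
    obtain b where b: "b \<in> B" "blinfun_apply b \<zeta> = \<omega>" using B_eval by blast
    have "blinfun_apply (\<sigma> c) (blinfun_apply (\<xi> o\<^sub>L b) \<zeta>) =
        blinfun_apply (\<xi> o\<^sub>L b) (blinfun_apply c \<zeta>)"
      using G_eval[OF compose[OF \<xi> b(1)]] c by (simp add: \<sigma>_def)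
    then show ?thesis using b by (simp add: commute_apply[OF b(1) c])
  qed
  have eqI: "S = T"
    if "S \<in> clinear_ops" "T \<in> clinear_ops"
      and "\<And>\<xi> \<omega>. \<xi> \<in> \<alpha> \<Longrightarrow> blinfun_apply S (blinfun_apply \<xi> \<omega>) = blinfun_apply T (blinfun_apply \<xi> \<omega>)"
    for S T :: "'k \<Rightarrow>\<^sub>L 'k"
    using that by (intro total_clinear_ops_eqI[OF total]) (auto simp: op_images_def)
  note Bd_add = complex_vector.subspace_add[OF Bd_subspace]
    and Bd_scale = complex_vector.subspace_scale[OF Bd_subspace]
  have "representation Bd \<sigma>"
    unfolding representation_def
  proof (intro conjI ballI allI)
    show "\<sigma> \<in> Bd \<rightarrow>\<^sub>E clinear_ops" using G by (auto simp: \<sigma>_def)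
  next
    fix c d assume c: "c \<in> Bd" and d: "d \<in> Bd"
    show "\<sigma> (c + d) = \<sigma> c + \<sigma> d"
      by (rule eqI) (use c d in \<open>auto simp: \<sigma> clin Bd_add blinfun.add_left blinfun.add_right
          intro: complex_vector.subspace_add[OF csubspace_clinear_ops]\<close>)
    show "\<sigma> (c o\<^sub>L d) = \<sigma> c o\<^sub>L \<sigma> d"
      by (rule eqI) (use c d in \<open>auto simp: \<sigma> clin Bd_compose compose_clinear_ops\<close>)
  next
    fix k c assume c: "c \<in> Bd"
    show "\<sigma> (k *\<^sub>C c) = k *\<^sub>C \<sigma> c"
      by (rule eqI) (use c clinear in \<open>auto simp: \<sigma> clin Bd_scale scaleC_blinfun.rep_eq clinear_opsD
          intro: complex_vector.subspace_scale[OF csubspace_clinear_ops]\<close>)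
  next
    fix c assume c: "c \<in> Bd"
    have "cinner (blinfun_apply (\<sigma> (adj c)) y) x = cinner y (blinfun_apply (\<sigma> c) x)" for x y
    proof -
      obtain \<xi> \<eta> where "\<xi> \<in> \<alpha>" "blinfun_apply \<xi> \<zeta> = x" "\<eta> \<in> \<alpha>" "blinfun_apply \<eta> \<zeta> = y"
        using eval by metis
      then show ?thesis using c cinner_shift[of \<xi> \<eta> c \<zeta> \<zeta>] \<sigma> Bd_adj by metis
    qed
    then show "\<sigma> (adj c) = adj (\<sigma> c)" by (metis adj_unique)
  qed
  moreover have "\<sigma> id_blinfun = id_blinfun"
    by (rule eqI) (auto simp: \<sigma> clin id_in_Bd)
  then have "id_blinfun \<in> \<sigma> ` Bd" using id_in_Bd by force
  then have "op_images (\<sigma> ` Bd) UNIV = UNIV"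
    unfolding op_images_def by (auto intro!: exI[of _ id_blinfun])
  then have "nondegenerate (\<sigma> ` Bd)"
    using subset_closed_cspan unfolding nondegenerate_def by blast
  moreover have "inj_on \<sigma> Bd"
  proof (rule inj_onI)
    fix c d assume cd: "c \<in> Bd" "d \<in> Bd" "\<sigma> c = \<sigma> d"
    have cd': "c - d \<in> Bd" using complex_vector.subspace_diff[OF Bd_subspace] cd by blast
    \<comment> \<open>Every \<open>\<xi> \<in> \<alpha>\<close> kills the range of \<open>c - d\<close>, hence so does every product \<open>\<eta>\<^sup>* \<xi>\<close>,
      and the closed span of these products is \<open>B\<close>, which contains the identity.\<close>
    have "blinfun_apply \<xi> (blinfun_apply (c - d) \<zeta>) = 0" if "\<xi> \<in> \<alpha>" for \<xi>
      using \<sigma>[OF cd(1) that, of \<zeta>] \<sigma>[OF cd(2) that, of \<zeta>] cd(3)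
      by (simp add: blinfun.diff_left blinfun.diff_right)
    then have "op_products (adj ` \<alpha>) \<alpha> \<subseteq> {b. blinfun_apply b (blinfun_apply (c - d) \<zeta>) = 0}"
      by (auto simp: op_products_def blinfun.zero_right)
    then have "closed_cspan (op_products (adj ` \<alpha>) \<alpha>) \<subseteq>
        {b. blinfun_apply b (blinfun_apply (c - d) \<zeta>) = 0}"
      by (rule closed_cspan_minimal)
        (auto simp: complex_vector.subspace_def blinfun.add_left scaleC_blinfun.rep_eq
          blinfun.zero_left intro!: closed_Collect_eq continuous_intros)
    then have "blinfun_apply id_blinfun (blinfun_apply (c - d) \<zeta>) = 0"
      using factorization id_in_B unfolding cstar_factorization_def by blast
    then show "c = d" using Bd_separating[OF cd'] by simp
  qed
  ultimately have "induces_representation Bd \<alpha> \<sigma>"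
    using \<sigma> by (auto simp: induces_representation_def nondegenerate_faithful_representation_def)
  then show ?thesis by blast
qed

end

section \<open>The factorization associated with a representation\<close>

text \<open>
  A nondegenerate faithful representation \<open>\<rho>\<close> of \<open>Bd\<close> on a finite-dimensional space, with frame
  \<open>K\<close>, over a finite-dimensional standard base.
\<close>

locale finite_representation = finite_standard_base B Bd \<zeta> E
  for B Bd :: "('h::complex_hilbert \<Rightarrow>\<^sub>L 'h) set" and \<zeta> E +
  fixes K :: "'k::complex_hilbert set" and \<rho> :: "('h \<Rightarrow>\<^sub>L 'h) \<Rightarrow> ('k \<Rightarrow>\<^sub>L 'k)"
  assumes frameK: "parseval_frame K UNIV"
    and rep: "nondegenerate_faithful_representation Bd \<rho>"
begin

abbreviation \<L> :: "('h \<Rightarrow>\<^sub>L 'k) set" where "\<L> \<equiv> intertwiners Bd \<rho>"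

lemma rep_simps:
  shows \<rho>_clinear: "c \<in> Bd \<Longrightarrow> \<rho> c \<in> clinear_ops"
    and \<rho>_add: "c \<in> Bd \<Longrightarrow> d \<in> Bd \<Longrightarrow> \<rho> (c + d) = \<rho> c + \<rho> d"
    and \<rho>_scale: "c \<in> Bd \<Longrightarrow> \<rho> (k *\<^sub>C c) = k *\<^sub>C \<rho> c"
    and \<rho>_compose: "c \<in> Bd \<Longrightarrow> d \<in> Bd \<Longrightarrow> \<rho> (c o\<^sub>L d) = \<rho> c o\<^sub>L \<rho> d"
    and \<rho>_adj: "c \<in> Bd \<Longrightarrow> \<rho> (adj c) = adj (\<rho> c)"
    and \<rho>_inj: "inj_on \<rho> Bd"
    and \<rho>_total: "closed_cspan (op_images (\<rho> ` Bd) UNIV) = UNIV"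
  using rep
  by (auto simp: nondegenerate_faithful_representation_def representation_def nondegenerate_def)

lemma \<rho>_id: "\<rho> id_blinfun = id_blinfun"
proof (rule total_clinear_ops_eqI[OF \<rho>_total])
  fix y assume "y \<in> op_images (\<rho> ` Bd) UNIV"
  then obtain c x where c: "c \<in> Bd" "y = blinfun_apply (\<rho> c) x" by (auto simp: op_images_def)
  have "id_blinfun o\<^sub>L c = c" by (simp add: blinfun_eqI)
  then show "blinfun_apply (\<rho> id_blinfun) y = blinfun_apply id_blinfun y"
    using \<rho>_compose[OF id_in_Bd c(1)] c(2)
    by (metis blinfun_apply_blinfun_compose id_blinfun.rep_eq id_apply)
qed (simp_all add: \<rho>_clinear id_in_Bd)

lemma intertwines: "T \<in> \<L> \<Longrightarrow> c \<in> Bd \<Longrightarrow> T o\<^sub>L c = \<rho> c o\<^sub>L T"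
  and \<L>_clinear: "T \<in> \<L> \<Longrightarrow> T \<in> clinear_ops"
  by (auto simp: intertwiners_def)

lemma intertwines_apply:
  "T \<in> \<L> \<Longrightarrow> c \<in> Bd \<Longrightarrow> blinfun_apply T (blinfun_apply c x) = blinfun_apply (\<rho> c) (blinfun_apply T x)"
  using intertwines by (metis blinfun_apply_blinfun_compose)

lemma \<L>I:
  "T \<in> clinear_ops \<Longrightarrow>
   (\<And>c x. c \<in> Bd \<Longrightarrow> blinfun_apply T (blinfun_apply c x) = blinfun_apply (\<rho> c) (blinfun_apply T x))
   \<Longrightarrow> T \<in> \<L>"
  by (auto simp: intertwiners_def intro!: blinfun_eqI)

lemma \<L>_eqI: "S \<in> \<L> \<Longrightarrow> T \<in> \<L> \<Longrightarrow> blinfun_apply S \<zeta> = blinfun_apply T \<zeta> \<Longrightarrow> S = T"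
  by (rule intertwiner_eqI[OF Bd_eval intertwines intertwines])

text \<open>
  Since \<open>\<zeta>\<close> is separating for \<open>Bd\<close>, the orbit map \<open>c \<zeta> \<mapsto> \<rho>(c) \<eta>\<close> is well defined; it is an
  intertwiner that sends \<open>\<zeta>\<close> to \<open>\<eta>\<close>.
\<close>

lemma \<L>_eval: "\<exists>T\<in>\<L>. blinfun_apply T \<zeta> = \<eta>"
proof -
  obtain T where T: "T \<in> clinear_ops"
    "\<And>c. c \<in> Bd \<Longrightarrow> blinfun_apply T (blinfun_apply c \<zeta>) = blinfun_apply (\<rho> c) \<eta>"
    by (rule linear_factor_through_evaluation[OF frame Bd_subspace Bd_separating Bd_eval,
          where F = "\<lambda>c. blinfun_apply (\<rho> c) \<eta>"])
      (auto simp: \<rho>_add \<rho>_scale blinfun.add_left scaleC_blinfun.rep_eq)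
  have "T \<in> \<L>"
  proof (rule \<L>I[OF T(1)])
    fix c x assume c: "c \<in> Bd"
    obtain d where d: "d \<in> Bd" "blinfun_apply d \<zeta> = x" using Bd_eval by blast
    show "blinfun_apply T (blinfun_apply c x) = blinfun_apply (\<rho> c) (blinfun_apply T x)"
      using T(2)[OF Bd_compose[OF c d(1)]] T(2)[OF d(1)] c d by (simp add: \<rho>_compose)
  qed
  moreover have "blinfun_apply T \<zeta> = \<eta>" using T(2)[OF id_in_Bd] by (simp add: \<rho>_id)
  ultimately show ?thesis by blast
qed

lemma csubspace_\<L>: "csubspace \<L>"
  by (rule complex_vector.subspaceI)
    (auto intro!: \<L>I simp: blinfun.zero_left blinfun.zero_right blinfun.add_left blinfun.add_right
      scaleC_blinfun.rep_eq intertwines_apply \<rho>_clinear clinear_opsD \<L>_clinear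
      complex_vector.subspace_0 complex_vector.subspace_add complex_vector.subspace_scale
      csubspace_clinear_ops)

lemma closed_\<L>: "closed \<L>"
proof -
  have "\<L> = clinear_ops \<inter> (\<Inter>c\<in>Bd. {T. T o\<^sub>L c = \<rho> c o\<^sub>L T})" by (auto simp: intertwiners_def)
  then show ?thesis
    by (auto intro!: closed_Int closed_INT closed_clinear_ops closed_Collect_eq continuous_intros)
qed

lemma \<L>_compose: "T \<in> \<L> \<Longrightarrow> b \<in> B \<Longrightarrow> T o\<^sub>L b \<in> \<L>"
  by (rule \<L>I) (auto simp: compose_clinear_ops \<L>_clinear B_clinear commute_apply intertwines_apply)

lemma adj_\<L>_compose:
  assumes S: "S \<in> \<L>" and T: "T \<in> \<L>"
  shows "adj S o\<^sub>L T \<in> B"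
proof (rule in_B_if_commutes, intro blinfun_eqI cinner_eqI)
  fix c x v assume c: "c \<in> Bd"
  have "cinner v (blinfun_apply (adj S o\<^sub>L T o\<^sub>L c) x) =
      cinner (blinfun_apply S v) (blinfun_apply (\<rho> c) (blinfun_apply T x))"
    using S T c by (simp add: cinner_adj_right \<L>_clinear intertwines_apply)
  also have "\<dots> = cinner (blinfun_apply (\<rho> (adj c)) (blinfun_apply S v)) (blinfun_apply T x)"
    using c by (simp add: \<rho>_adj cinner_adj[OF frameK] \<rho>_clinear)
  also have "\<dots> = cinner v (blinfun_apply (c o\<^sub>L (adj S o\<^sub>L T)) x)"
    using S c by (simp add: intertwines_apply[symmetric] Bd_adj cinner_adj_right[of S, symmetric]
        cinner_adj_left \<L>_clinear Bd_clinear)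
  finally show "cinner v (blinfun_apply (adj S o\<^sub>L T o\<^sub>L c) x) =
    cinner v (blinfun_apply (c o\<^sub>L (adj S o\<^sub>L T)) x)" .
qed

text \<open>
  The products \<open>S\<^sup>* T\<close> of intertwiners span \<open>B\<close>. Let \<open>J\<close> be their span and let \<open>x = c \<zeta>\<close>, with
  \<open>c \<in> Bd\<close>, be orthogonal to \<open>J \<zeta>\<close>. Then \<open>T \<zeta>\<close> is orthogonal to \<open>S x\<close> for all intertwiners \<open>S\<close> and
  \<open>T\<close>, and \<open>T \<zeta>\<close> is arbitrary, so that \<open>\<rho>(c) S \<zeta> = S x = 0\<close>. As \<open>S \<zeta>\<close> is arbitrary too, \<open>\<rho>(c) = 0\<close>
  and \<open>c = 0\<close> by faithfulness. Hence \<open>J \<zeta>\<close> is everything, and an element of \<open>B\<close> is determined by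
  its value at \<open>\<zeta>\<close>.
\<close>

lemma B_eq_span_adj_\<L>: "B = cspan (op_products (adj ` \<L>) \<L>)"
proof
  let ?J = "cspan (op_products (adj ` \<L>) \<L>)"
  show JB: "?J \<subseteq> B"
    by (rule complex_vector.span_minimal[OF _ B_subspace])
      (auto simp: op_products_def adj_\<L>_compose)
  have "(\<lambda>j. blinfun_apply j \<zeta>) ` ?J = UNIV"
  proof (rule finite_dim_subspace_UNIV[OF parseval_frame_cspan[OF frame]])
    show "csubspace ((\<lambda>j. blinfun_apply j \<zeta>) ` ?J)"
      by (intro csubspace_eval complex_vector.subspace_span)
  next
    fix x assume x: "\<And>v. v \<in> (\<lambda>j. blinfun_apply j \<zeta>) ` ?J \<Longrightarrow> cinner v x = 0"
    obtain c where c: "c \<in> Bd" "blinfun_apply c \<zeta> = x" using Bd_eval by blast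
    have S: "blinfun_apply S x = 0" if S: "S \<in> \<L>" for S
    proof -
      obtain T where T: "T \<in> \<L>" "blinfun_apply T \<zeta> = blinfun_apply S x" using \<L>_eval by blast
      have "adj S o\<^sub>L T \<in> ?J"
        using S T by (intro complex_vector.span_base) (auto simp: op_products_def)
      then have "cinner (blinfun_apply (adj S o\<^sub>L T) \<zeta>) x = 0" using x by blast
      then show ?thesis using S T by (simp add: cinner_adj_left \<L>_clinear)
    qed
    have "\<rho> c = \<rho> 0"
    proof (rule blinfun_eqI)
      fix \<eta>
      obtain S where S': "S \<in> \<L>" "blinfun_apply S \<zeta> = \<eta>" using \<L>_eval by blast
      have "\<rho> 0 = 0" using \<rho>_scale[OF c(1), of 0] by simp
      then show "blinfun_apply (\<rho> c) \<eta> = blinfun_apply (\<rho> 0) \<eta>"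
        using intertwines_apply[OF S'(1) c(1), of \<zeta>] S[OF S'(1)] c S'
        by (simp add: blinfun.zero_left)
    qed
    then have "c = 0"
      using \<rho>_inj c(1) complex_vector.subspace_0[OF Bd_subspace] by (auto dest: inj_onD)
    then show "x = 0" using c(2) by (simp add: blinfun.zero_left)
  qed
  then have J: "\<exists>j\<in>?J. blinfun_apply j \<zeta> = x" for x by (metis UNIV_I imageE)
  show "B \<subseteq> ?J"
  proof
    fix b assume b: "b \<in> B"
    obtain j where j: "j \<in> ?J" "blinfun_apply j \<zeta> = blinfun_apply b \<zeta>" using J by blast
    have "b - j = 0"
      using j b JB complex_vector.subspace_diff[OF B_subspace, of b j]
      by (intro B_separating) (auto simp: blinfun.diff_left)
    then show "b \<in> ?J" using j(1) by simp
  qed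
qed

lemma factorization_\<L>: "cstar_factorization B Bd \<L>"
  unfolding cstar_factorization_def
proof (intro conjI csubspace_\<L> closed_\<L>)
  show "\<L> \<subseteq> clinear_ops" using \<L>_clinear by blast
  show "closed_cspan (op_products (adj ` \<L>) \<L>) = B"
    unfolding closed_cspan_def B_eq_span_adj_\<L>[symmetric] by (rule closure_closed[OF B_closed])
  have "op_products \<L> B \<subseteq> \<L>" by (auto simp: op_products_def \<L>_compose)
  moreover have "T = T o\<^sub>L id_blinfun" for T :: "'h \<Rightarrow>\<^sub>L 'k" by (simp add: blinfun_eqI)
  then have "\<L> \<subseteq> op_products \<L> B" unfolding op_products_def using id_in_B by blast
  ultimately show "closed_cspan (op_products \<L> B) = \<L>"
    using closed_cspan_minimal[OF _ csubspace_\<L> closed_\<L>] subset_closed_cspan by blast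
  have "x \<in> op_images \<L> UNIV" for x unfolding op_images_def using \<L>_eval[of x] by blast
  then show "closed_cspan (op_images \<L> UNIV) = UNIV" using subset_closed_cspan by blast
qed

lemma induces_iff:
  assumes "cstar_factorization B Bd \<alpha>"
  shows "induces_representation Bd \<alpha> \<rho> \<longleftrightarrow> \<alpha> = \<L>"
proof
  interpret finite_factorization B Bd \<zeta> E K \<alpha> by unfold_locales (fact frameK assms)+
  assume ind: "induces_representation Bd \<alpha> \<rho>"
  have sub: "\<alpha> \<subseteq> \<L>"
    using ind clinear by (auto intro!: \<L>I simp: induces_representation_def)
  moreover have "T \<in> \<alpha>" if T: "T \<in> \<L>" for T
  proof -
    obtain \<xi> where "\<xi> \<in> \<alpha>" "blinfun_apply \<xi> \<zeta> = blinfun_apply T \<zeta>" using eval by blast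
    then show ?thesis using \<L>_eqI[of \<xi> T] T sub by blast
  qed
  ultimately show "\<alpha> = \<L>" by blast
next
  assume "\<alpha> = \<L>"
  then show "induces_representation Bd \<alpha> \<rho>"
    using rep by (simp add: induces_representation_def intertwines_apply)
qed

end

section \<open>Factorizations and representations\<close>

theorem proposition2p8:
  fixes B Bd :: "('h::complex_hilbert \<Rightarrow>\<^sub>L 'h) set"
    and \<rho> :: "('h \<Rightarrow>\<^sub>L 'h) \<Rightarrow> ('k::complex_hilbert \<Rightarrow>\<^sub>L 'k)"
    and \<alpha> :: "('h \<Rightarrow>\<^sub>L 'k) set"
  assumes "standard_cstar_base B Bd"
    and "\<exists>S :: 'k set. finite S \<and> cspan S = UNIV"
    and "nondegenerate_faithful_representation Bd \<rho>"
    and "cstar_factorization B Bd \<alpha>"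
  shows "(\<exists>!\<sigma>. induces_representation Bd \<alpha> \<sigma>) \<and>
    cstar_factorization B Bd (intertwiners Bd \<rho>) \<and>
    (induced_representation Bd \<alpha> = \<rho> \<longleftrightarrow> \<alpha> = intertwiners Bd \<rho>)"
proof -
  obtain K :: "'k set" where K: "parseval_frame K UNIV"
    using assms(2) parseval_frame_exists by metis
  obtain \<zeta> where \<zeta>: "cyclic B \<zeta>" "cyclic Bd \<zeta>"
    using assms(1) by (auto simp: standard_cstar_base_def bicyclic_def)
  have base: "cstar_algebra B" "cstar_algebra Bd"
    "\<And>b c. b \<in> B \<Longrightarrow> c \<in> Bd \<Longrightarrow> b o\<^sub>L c = c o\<^sub>L b"
    using assms(1) by (auto simp: standard_cstar_base_def cstar_base_def)
  then have sub: "csubspace B" "csubspace Bd" by (auto simp: cstar_algebra_def)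
  obtain E :: "'h set" where E: "parseval_frame E UNIV"
    using finite_dim_if_cyclic[OF K sub(2) _ _ \<zeta>(2)] assms(3)
    unfolding nondegenerate_faithful_representation_def by metis
  interpret finite_factorization B Bd \<zeta> E K \<alpha>
    using K E base assms(4) cyclic_finite_dim[OF E sub(1) \<zeta>(1)] cyclic_finite_dim[OF E sub(2) \<zeta>(2)]
    by unfold_locales auto
  interpret R: finite_representation B Bd \<zeta> E K \<rho>
    by unfold_locales (fact K assms(3))+
  have ex1: "\<exists>!\<sigma>. induces_representation Bd \<alpha> \<sigma>"
    using induced_exists induced_unique by blast
  then have "induced_representation Bd \<alpha> = \<rho> \<longleftrightarrow> induces_representation Bd \<alpha> \<rho>"
    unfolding induced_representation_def by (metis theI')
  then show ?thesis using ex1 R.factorization_\<L> R.induces_iff[OF assms(4)] by blast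
qed

end
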